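(* If $R$ is a closed localic relation with open source on a locale $X$, and $\Downarrow$ is its induced cone, then $R\cong R_{\Downarrow}$ as sublocales of $X\times X$.
   Context: A locale $X$ has frame of opens $\mathcal{O}X$, and a locale map $f\colon X\to Y$ is a frame map $f^{-1}\colon\mathcal{O}Y\to\mathcal{O}X$. A sublocale is an (equivalence class of an) extremal monomorphism of locales, equivalently a frame congruence. $\mathcal{O}(X\times X)=\mathcal{O}X\otimes\mathcal{O}X$ is the frame coproduct, generated under joins by rectangles $x\otimes y$. A localic relation on $X$ is a sublocale $r\colon R\rightarrowtail X\times X$, with source $s=\mathrm{pr}_1 r$ and target $t=\mathrm{pr}_2 r$. $R$ is closed if there is $u\in\mathcal{O}X\otimes\mathcal{O}X$ such that $R$ is given by the frame quotient $o\mapsto o\vee u$ onto $\{o:u\le o\}$. A locale map $f$ is open if $f^{-1}$ has a left adjoint $f_!$ with $f_!(U\wedge f^{-1}(V))=f_!(U)\wedge V$. $R$ has open source if $s$ is open, and then its induced cone is $\Downarrow:=s_!\circ t^{-1}\colon\mathcal{O}X\to\mathcal{O}X$, which preserves joins. For a join-preserving function $\triangledown\colon\mathcal{O}X\to\mathcal{O}X$, the induced relation $R_\triangledown$ is the sublocale of $X\times X$ given by the smallest frame congruence on $\mathcal{O}X\otimes\mathcal{O}X$ identifying $x\otimes y$ with $(x\wedge\triangledown y)\otimes y$ for all $x,y\in\mathcal{O}X$. $R_{\Downarrow}$ is the case $\triangledown=\Downarrow$. *)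

theory Defs
  imports Main
begin

section \<open>Frames and frame maps\<close>

text \<open>A locale X is represented by its frame of opens, a type of class \<open>frame\<close>; a locale map
  from X to Y is represented by its frame map from the opens of Y to the opens of X.\<close>

class frame = complete_lattice +
  assumes inf_Sup_frame: "inf a (Sup B) = (SUP b\<in>B. inf a b)"

definition frame_hom :: "('a::frame \<Rightarrow> 'b::frame) \<Rightarrow> bool" where
  "frame_hom f \<longleftrightarrow> f top = top \<and> (\<forall>x y. f (inf x y) = inf (f x) (f y)) \<and> (\<forall>A. f (Sup A) = Sup (f ` A))"

definition left_adjoint :: "('a::order \<Rightarrow> 'b::order) \<Rightarrow> ('b \<Rightarrow> 'a) \<Rightarrow> bool" where
  "left_adjoint g f \<longleftrightarrow> (\<forall>U V. g U \<le> V \<longleftrightarrow> U \<le> f V)"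

definition open_locale_map :: "('b::frame \<Rightarrow> 'a::frame) \<Rightarrow> bool" where
  "open_locale_map f \<longleftrightarrow> frame_hom f \<and>
     (\<exists>g. left_adjoint g f \<and> (\<forall>U V. g (inf U (f V)) = inf (g U) V))"

text \<open>A left adjoint is unique when it exists, so the description below denotes it; the value is
  irrelevant otherwise.\<close>

definition direct_image :: "('b::order \<Rightarrow> 'a::order) \<Rightarrow> 'a \<Rightarrow> 'b" where
  "direct_image f = (THE g. left_adjoint g f)"

lemma direct_image_eq:
  assumes "left_adjoint g f"
  shows "direct_image f = g"
  unfolding direct_image_def
proof (rule the_equality)
  show "left_adjoint g f" by fact
  fix h assume "left_adjoint h f"
  with assms show "h = g"
    unfolding left_adjoint_def fun_eq_iff by (meson order.antisym order.refl)
qed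


section \<open>The frame coproduct\<close>

text \<open>The coproduct is realised by the down-sets of the product that are closed under joins in each
  coordinate separately (the empty join included). Its universal property is proved below.\<close>

definition coprod_ideal :: "('a::frame \<times> 'b::frame) set \<Rightarrow> bool" where
  "coprod_ideal D \<longleftrightarrow>
     (\<forall>a b a' b'. (a, b) \<in> D \<longrightarrow> a' \<le> a \<longrightarrow> b' \<le> b \<longrightarrow> (a', b') \<in> D) \<and>
     (\<forall>A b. (\<forall>a\<in>A. (a, b) \<in> D) \<longrightarrow> (Sup A, b) \<in> D) \<and>
     (\<forall>a B. (\<forall>b\<in>B. (a, b) \<in> D) \<longrightarrow> (a, Sup B) \<in> D)"

lemma coprod_ideal_Inter: "(\<And>D. D \<in> S \<Longrightarrow> coprod_ideal D) \<Longrightarrow> coprod_ideal (\<Inter>S)"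
  unfolding coprod_ideal_def Inter_iff by meson

typedef (overloaded) ('a::frame, 'b::frame) coprod = "{D :: ('a \<times> 'b) set. coprod_ideal D}"
  morphisms opens_below Abs_coprod
  by (rule exI[of _ UNIV]) (simp add: coprod_ideal_def)

setup_lifting type_definition_coprod

instantiation coprod :: (frame, frame) complete_lattice
begin

lift_definition less_eq_coprod :: "('a, 'b) coprod \<Rightarrow> ('a, 'b) coprod \<Rightarrow> bool" is "(\<subseteq>)" .
lift_definition less_coprod :: "('a, 'b) coprod \<Rightarrow> ('a, 'b) coprod \<Rightarrow> bool" is "(\<subset>)" .
lift_definition inf_coprod :: "('a, 'b) coprod \<Rightarrow> ('a, 'b) coprod \<Rightarrow> ('a, 'b) coprod" is "(\<inter>)"
proof -
  fix C D :: "('a \<times> 'b) set" assume "coprod_ideal C" "coprod_ideal D"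
  then show "coprod_ideal (C \<inter> D)" using coprod_ideal_Inter[of "{C, D}"] by auto
qed
lift_definition Inf_coprod :: "('a, 'b) coprod set \<Rightarrow> ('a, 'b) coprod" is Inter
  by (rule coprod_ideal_Inter) simp
lift_definition top_coprod :: "('a, 'b) coprod" is UNIV
  by (simp add: coprod_ideal_def)
lift_definition Sup_coprod :: "('a, 'b) coprod set \<Rightarrow> ('a, 'b) coprod"
  is "\<lambda>S. \<Inter>{D. coprod_ideal D \<and> \<Union>S \<subseteq> D}"
  by (rule coprod_ideal_Inter) simp
lift_definition sup_coprod :: "('a, 'b) coprod \<Rightarrow> ('a, 'b) coprod \<Rightarrow> ('a, 'b) coprod"
  is "\<lambda>C C'. \<Inter>{D. coprod_ideal D \<and> C \<union> C' \<subseteq> D}"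
  by (rule coprod_ideal_Inter) simp
lift_definition bot_coprod :: "('a, 'b) coprod" is "\<Inter>{D. coprod_ideal D}"
  by (rule coprod_ideal_Inter) simp

instance
  by standard (transfer; blast)+

end

text \<open>Distributivity: binary meet with a fixed element has a right adjoint, the Heyting implication.\<close>

lift_definition coprod_imp :: "('a::frame, 'b::frame) coprod \<Rightarrow> ('a, 'b) coprod \<Rightarrow> ('a, 'b) coprod"
  is "\<lambda>C D. {(a, b). \<forall>c d. (c, d) \<in> C \<longrightarrow> (inf c a, inf d b) \<in> D}"
proof -
  fix C D :: "('a \<times> 'b) set" assume "coprod_ideal C" and D: "coprod_ideal D"
  show "coprod_ideal {(a, b). \<forall>c d. (c, d) \<in> C \<longrightarrow> (inf c a, inf d b) \<in> D}"
    unfolding coprod_ideal_def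
  proof (intro conjI allI impI; clarsimp)
    fix a b a' b' c d
    assume "\<forall>c d. (c, d) \<in> C \<longrightarrow> (inf c a, inf d b) \<in> D" "a' \<le> a" "b' \<le> b" "(c, d) \<in> C"
    moreover from this have "inf c a' \<le> inf c a" "inf d b' \<le> inf d b" by (auto intro: le_infI1 le_infI2)
    ultimately show "(inf c a', inf d b') \<in> D" using D unfolding coprod_ideal_def by meson
  next
    fix A b c d
    assume "\<forall>a\<in>A. \<forall>c d. (c, d) \<in> C \<longrightarrow> (inf c a, inf d b) \<in> D" "(c, d) \<in> C"
    then have "\<forall>a\<in>inf c ` A. (a, inf d b) \<in> D" by auto
    then show "(inf c (Sup A), inf d b) \<in> D"
      using D unfolding inf_Sup_frame coprod_ideal_def by blast
  next
    fix a B c d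
    assume "\<forall>b\<in>B. \<forall>c d. (c, d) \<in> C \<longrightarrow> (inf c a, inf d b) \<in> D" "(c, d) \<in> C"
    then have "\<forall>b\<in>inf d ` B. (inf c a, b) \<in> D" by auto
    then show "(inf c a, inf d (Sup B)) \<in> D"
      using D unfolding inf_Sup_frame coprod_ideal_def by blast
  qed
qed

lemma coprod_imp_adjoint: "inf C E \<le> D \<longleftrightarrow> E \<le> coprod_imp C D"
proof (transfer, intro iffI)
  fix C E D :: "('a \<times> 'b) set"
  assume *: "coprod_ideal C" "coprod_ideal E" "coprod_ideal D" and sub: "C \<inter> E \<subseteq> D"
  show "E \<subseteq> {(a, b). \<forall>c d. (c, d) \<in> C \<longrightarrow> (inf c a, inf d b) \<in> D}"
  proof clarify
    fix a b c d assume "(a, b) \<in> E" "(c, d) \<in> C"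
    then have "(inf c a, inf d b) \<in> E" "(inf c a, inf d b) \<in> C"
      using * unfolding coprod_ideal_def by (meson inf_le1 inf_le2)+
    with sub show "(inf c a, inf d b) \<in> D" by blast
  qed
next
  fix C E D :: "('a \<times> 'b) set"
  assume "E \<subseteq> {(a, b). \<forall>c d. (c, d) \<in> C \<longrightarrow> (inf c a, inf d b) \<in> D}"
  then show "C \<inter> E \<subseteq> D" by fastforce
qed

instance coprod :: (frame, frame) frame
proof
  fix C :: "('a, 'b) coprod" and S
  have "S' \<le> coprod_imp C (SUP D\<in>S. inf C D)" if "S' \<in> S" for S'
    unfolding coprod_imp_adjoint[symmetric] using that by (rule SUP_upper)
  then have "Sup S \<le> coprod_imp C (SUP D\<in>S. inf C D)" by (rule Sup_least)
  then show "inf C (Sup S) = (SUP D\<in>S. inf C D)"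
    unfolding coprod_imp_adjoint[symmetric]
    by (intro order.antisym) (auto intro!: SUP_least simp: le_infI2 Sup_upper)
qed

lift_definition rect :: "'a::frame \<Rightarrow> 'b::frame \<Rightarrow> ('a, 'b) coprod"  (infix "\<otimes>" 75)
  is "\<lambda>x y. \<Inter>{D. coprod_ideal D \<and> (x, y) \<in> D}"
  by (rule coprod_ideal_Inter) simp

definition pr1 :: "'a::frame \<Rightarrow> ('a, 'b::frame) coprod" where "pr1 x = x \<otimes> top"
definition pr2 :: "'b::frame \<Rightarrow> ('a::frame, 'b) coprod" where "pr2 y = top \<otimes> y"

lemma rect_le_iff: "x \<otimes> y \<le> D \<longleftrightarrow> (x, y) \<in> opens_below D"
  by transfer blast

lemma opens_below_ideal: "coprod_ideal (opens_below D)"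
  using opens_below by auto

lemma opens_below_down: "(a, b) \<in> opens_below D \<Longrightarrow> a' \<le> a \<Longrightarrow> b' \<le> b \<Longrightarrow> (a', b') \<in> opens_below D"
  using opens_below_ideal[of D] unfolding coprod_ideal_def by meson

lemma opens_below_Sup_left: "(\<And>a. a \<in> A \<Longrightarrow> (a, b) \<in> opens_below D) \<Longrightarrow> (Sup A, b) \<in> opens_below D"
  using opens_below_ideal[of D] unfolding coprod_ideal_def by meson

lemma opens_below_Sup_right: "(\<And>b. b \<in> B \<Longrightarrow> (a, b) \<in> opens_below D) \<Longrightarrow> (a, Sup B) \<in> opens_below D"
  using opens_below_ideal[of D] unfolding coprod_ideal_def by meson

lemma coprod_eq_Sup_rect: "D = (SUP (x, y)\<in>opens_below D. x \<otimes> y)" (is "_ = ?S")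
proof (rule order.antisym)
  have "opens_below D \<subseteq> opens_below ?S"
  proof clarify
    fix x y assume "(x, y) \<in> opens_below D"
    then have "x \<otimes> y \<le> ?S" by (metis (mono_tags, lifting) SUP_upper case_prod_conv)
    then show "(x, y) \<in> opens_below ?S" by (simp add: rect_le_iff)
  qed
  then show "D \<le> ?S" by (simp add: less_eq_coprod.rep_eq)
  show "?S \<le> D" by (auto intro!: SUP_least simp: rect_le_iff)
qed

lemma rect_mono: "a \<le> a' \<Longrightarrow> b \<le> b' \<Longrightarrow> a \<otimes> b \<le> a' \<otimes> b'"
  unfolding rect_le_iff[of a b] using rect_le_iff[of a' b' "a' \<otimes> b'"]
  by (blast intro: opens_below_down)

lemma rect_Sup_left: "Sup A \<otimes> y = (SUP x\<in>A. x \<otimes> y)"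
proof (rule order.antisym)
  show "Sup A \<otimes> y \<le> (SUP x\<in>A. x \<otimes> y)"
    unfolding rect_le_iff
    by (rule opens_below_Sup_left) (auto simp: rect_le_iff[symmetric] intro: SUP_upper)
qed (auto intro!: SUP_least rect_mono Sup_upper)

lemma rect_Sup_right: "x \<otimes> Sup B = (SUP y\<in>B. x \<otimes> y)"
proof (rule order.antisym)
  show "x \<otimes> Sup B \<le> (SUP y\<in>B. x \<otimes> y)"
    unfolding rect_le_iff
    by (rule opens_below_Sup_right) (auto simp: rect_le_iff[symmetric] intro: SUP_upper)
qed (auto intro!: SUP_least rect_mono Sup_upper)

lemma opens_below_rect:
  "opens_below (x \<otimes> y) = {(a, b). a \<le> x \<and> b \<le> y \<or> a = bot \<or> b = bot}" (is "_ = ?D")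
proof
  have "coprod_ideal ?D"
    unfolding coprod_ideal_def
  proof (intro conjI allI impI)
    fix a b a' b'
    assume "(a, b) \<in> ?D" "a' \<le> a" "b' \<le> b"
    then show "(a', b') \<in> ?D" by (auto simp: bot_unique)
  next
    fix A b
    assume "\<forall>a\<in>A. (a, b) \<in> ?D"
    then show "(Sup A, b) \<in> ?D" by (cases "b \<le> y") (auto simp: Sup_le_iff)
  next
    fix a B
    assume "\<forall>b\<in>B. (a, b) \<in> ?D"
    then show "(a, Sup B) \<in> ?D" by (cases "a \<le> x") (auto simp: Sup_le_iff)
  qed
  moreover have "(x, y) \<in> ?D" by simp
  ultimately show "opens_below (x \<otimes> y) \<subseteq> ?D" unfolding rect.rep_eq by blast
  have "(Sup {}, b) \<in> opens_below (x \<otimes> y)" "(a, Sup {}) \<in> opens_below (x \<otimes> y)" for a b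
    by (rule opens_below_Sup_left opens_below_Sup_right; simp)+
  moreover have "a \<le> x \<Longrightarrow> b \<le> y \<Longrightarrow> (a, b) \<in> opens_below (x \<otimes> y)" for a b
    by (simp add: rect_le_iff[symmetric] rect_mono)
  ultimately show "?D \<subseteq> opens_below (x \<otimes> y)" by auto
qed

lemma inf_rect: "inf (a \<otimes> b) (c \<otimes> d) = inf a c \<otimes> inf b d"
proof -
  have "opens_below (inf (a \<otimes> b) (c \<otimes> d)) = opens_below (inf a c \<otimes> inf b d)"
    by (auto simp: inf_coprod.rep_eq opens_below_rect)
  then show ?thesis by (simp add: opens_below_inject)
qed

lemma top_rect: "top \<otimes> top = top"
  by (rule top.extremum_uniqueI)
    (simp add: less_eq_coprod.rep_eq opens_below_rect top_coprod.rep_eq)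

lemma frame_hom_pr1: "frame_hom pr1"
  by (simp add: frame_hom_def pr1_def top_rect inf_rect rect_Sup_left image_image)

lemma frame_hom_pr2: "frame_hom pr2"
  by (simp add: frame_hom_def pr2_def top_rect inf_rect rect_Sup_right image_image)

lemma rect_eq_inf_pr: "x \<otimes> y = inf (pr1 x) (pr2 y)"
  by (simp add: pr1_def pr2_def inf_rect)

lemma frame_hom_mono: "frame_hom f \<Longrightarrow> x \<le> y \<Longrightarrow> f x \<le> f y"
  unfolding frame_hom_def by (metis inf.absorb_iff1 inf_le2)

theorem coprod_universal:
  fixes f :: "'a::frame \<Rightarrow> 'c::frame" and g :: "'b::frame \<Rightarrow> 'c"
  assumes f: "frame_hom f" and g: "frame_hom g"
  shows "\<exists>!h. frame_hom h \<and> h \<circ> pr1 = f \<and> h \<circ> pr2 = g"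
proof -
  define h where "h D = (SUP (x, y)\<in>opens_below D. inf (f x) (g y))" for D
  have h_le: "h D \<le> c \<longleftrightarrow> (\<forall>(x, y)\<in>opens_below D. inf (f x) (g y) \<le> c)" for D c
    unfolding h_def SUP_le_iff by (simp add: case_prod_beta)
  have fd: "f (Sup A) = Sup (f ` A)" "f top = top" "f (inf x x') = inf (f x) (f x')"
    and gd: "g (Sup B) = Sup (g ` B)" "g top = top" "g (inf y y') = inf (g y) (g y')" for A B x x' y y'
    using f g by (auto simp: frame_hom_def)
  have inf_SUP': "inf c (Sup (k ` A)) = (SUP a\<in>A. inf c (k a))"
    for c :: 'c and k and A :: "'z set"
    by (simp add: inf_Sup_frame image_image)
  have ideal: "coprod_ideal {(x, y). inf (f x) (g y) \<le> c}" (is "coprod_ideal ?D") for c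
    unfolding coprod_ideal_def
  proof (intro conjI allI impI)
    fix a a' b b' assume ab: "(a, b) \<in> ?D" and le: "a' \<le> a" "b' \<le> b"
    have "inf (f a') (g b') \<le> inf (f a) (g b)"
      by (intro inf_mono frame_hom_mono[OF f] frame_hom_mono[OF g] le)
    also have "\<dots> \<le> c" using ab by simp
    finally show "(a', b') \<in> ?D" by simp
  next
    fix A b assume A: "\<forall>a\<in>A. (a, b) \<in> ?D"
    have "inf (g b) (f (Sup A)) \<le> c"
      unfolding fd inf_SUP' by (rule SUP_least) (use A in \<open>simp add: inf_commute\<close>)
    then show "(Sup A, b) \<in> ?D" by (simp add: inf_commute)
  next
    fix a B assume B: "\<forall>b\<in>B. (a, b) \<in> ?D"
    have "inf (f a) (g (Sup B)) \<le> c"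
      unfolding gd inf_SUP' by (rule SUP_least) (use B in simp)
    then show "(a, Sup B) \<in> ?D" by simp
  qed
  have h_rect: "h (x \<otimes> y) = inf (f x) (g y)" for x y
  proof (rule order.antisym)
    have "opens_below (x \<otimes> y) \<subseteq> {(a, b). inf (f a) (g b) \<le> inf (f x) (g y)}"
      using ideal[of "inf (f x) (g y)"] unfolding rect.rep_eq by blast
    then show "h (x \<otimes> y) \<le> inf (f x) (g y)" unfolding h_le by blast
    show "inf (f x) (g y) \<le> h (x \<otimes> y)"
      using h_le[of "x \<otimes> y" "h (x \<otimes> y)"] by (auto simp: opens_below_rect)
  qed
  have h_mono: "h D \<le> h E" if "D \<le> E" for D E
    unfolding h_def by (rule SUP_subset_mono) (use that in \<open>auto simp: less_eq_coprod.rep_eq\<close>)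
  have h_Sup: "h (Sup S) = Sup (h ` S)" for S
  proof (rule order.antisym)
    have "\<forall>D\<in>S. opens_below D \<subseteq> {(x, y). inf (f x) (g y) \<le> Sup (h ` S)}"
    proof clarify
      fix D x y assume "D \<in> S" "(x, y) \<in> opens_below D"
      then have "inf (f x) (g y) \<le> h D" "h D \<le> Sup (h ` S)"
        using h_le[of D "h D"] by (auto intro: SUP_upper)
      then show "inf (f x) (g y) \<le> Sup (h ` S)" by order
    qed
    then have "opens_below (Sup S) \<subseteq> {(x, y). inf (f x) (g y) \<le> Sup (h ` S)}"
      using ideal[of "Sup (h ` S)"] unfolding Sup_coprod.rep_eq by blast
    then show "h (Sup S) \<le> Sup (h ` S)" unfolding h_le by blast
    show "Sup (h ` S) \<le> h (Sup S)" by (auto intro!: SUP_least h_mono Sup_upper)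
  qed
  have h_inf: "h (inf D E) = inf (h D) (h E)" for D E
  proof (rule order.antisym)
    show "h (inf D E) \<le> inf (h D) (h E)" by (simp add: h_mono)
    have "inf (inf (f x) (g y)) (inf (f x') (g y')) \<le> h (inf D E)"
      if "(x, y) \<in> opens_below D" "(x', y') \<in> opens_below E" for x y x' y'
    proof -
      have "inf (x \<otimes> y) (x' \<otimes> y') \<le> inf D E"
        using that by (intro inf_mono) (auto simp: rect_le_iff)
      then have "h (inf x x' \<otimes> inf y y') \<le> h (inf D E)" by (intro h_mono) (simp add: inf_rect)
      then show ?thesis by (simp add: h_rect fd gd inf_assoc inf_left_commute)
    qed
    then have "inf (inf (f x) (g y)) (h E) \<le> h (inf D E)" if "(x, y) \<in> opens_below D" for x y
      unfolding h_def[of E] inf_SUP' using that by (auto intro!: SUP_least)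
    then have "inf (h E) (h D) \<le> h (inf D E)"
      unfolding h_def[of D] inf_SUP' by (auto intro!: SUP_least simp: inf_commute)
    then show "inf (h D) (h E) \<le> h (inf D E)" by (simp add: inf_commute)
  qed
  have "frame_hom h"
    unfolding frame_hom_def using h_Sup h_inf h_rect[of top top] by (simp add: top_rect fd gd)
  moreover have "h \<circ> pr1 = f" "h \<circ> pr2 = g"
    by (auto simp: fun_eq_iff pr1_def pr2_def h_rect fd gd)
  moreover have "k = h" if k: "frame_hom k" "k \<circ> pr1 = f" "k \<circ> pr2 = g" for k
  proof
    fix D
    have "k (x \<otimes> y) = inf (f x) (g y)" for x y
      using k by (auto simp: rect_eq_inf_pr frame_hom_def)
    then have *: "k (x \<otimes> y) = h (x \<otimes> y)" for x y by (simp add: h_rect)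
    have "k (SUP (x, y)\<in>opens_below D. x \<otimes> y) = h (SUP (x, y)\<in>opens_below D. x \<otimes> y)"
      using k(1) by (simp add: h_Sup frame_hom_def image_image case_prod_beta *)
    then show "k D = h D" using coprod_eq_Sup_rect[of D] by metis
  qed
  ultimately show ?thesis by blast
qed


section \<open>Sublocales and frame congruences\<close>

text \<open>Joins of arbitrary families of congruent pairs are indexed by the set of pairs itself.\<close>

definition frame_congruence :: "('a::frame \<times> 'a) set \<Rightarrow> bool" where
  "frame_congruence \<theta> \<longleftrightarrow> equiv UNIV \<theta> \<and>
     (\<forall>a a' b b'. (a, a') \<in> \<theta> \<longrightarrow> (b, b') \<in> \<theta> \<longrightarrow> (inf a b, inf a' b') \<in> \<theta>) \<and>
     (\<forall>S. S \<subseteq> \<theta> \<longrightarrow> (Sup (fst ` S), Sup (snd ` S)) \<in> \<theta>)"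

text \<open>The extremal monomorphisms of locales are the locale maps whose frame map is surjective.\<close>

definition sublocale_map :: "('a::frame \<Rightarrow> 'r::frame) \<Rightarrow> bool" where
  "sublocale_map r \<longleftrightarrow> frame_hom r \<and> surj r"

definition congruence_of :: "('a \<Rightarrow> 'r) \<Rightarrow> ('a \<times> 'a) set" where
  "congruence_of r = {(a, b). r a = r b}"

lemma frame_congruence_of:
  assumes "frame_hom r"
  shows "frame_congruence (congruence_of r)"
proof -
  have "(Sup (fst ` S), Sup (snd ` S)) \<in> congruence_of r" if "S \<subseteq> congruence_of r" for S
  proof -
    have "r ` fst ` S = r ` snd ` S"
      unfolding image_image by (rule image_cong) (use that in \<open>auto simp: congruence_of_def\<close>)
    then show ?thesis using assms by (simp add: congruence_of_def frame_hom_def)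
  qed
  then show ?thesis
    using assms
    by (auto simp: frame_congruence_def congruence_of_def frame_hom_def equiv_def refl_on_def
        intro: symI transI)
qed

text \<open>Hence equality of congruences is isomorphism of sublocales.\<close>

lemma congruence_of_eq_iff:
  fixes r :: "'a::frame \<Rightarrow> 'r::frame" and q :: "'a \<Rightarrow> 'q::frame"
  assumes r: "sublocale_map r" and q: "sublocale_map q"
  shows "congruence_of r = congruence_of q \<longleftrightarrow> (\<exists>\<phi>. frame_hom \<phi> \<and> bij \<phi> \<and> q = \<phi> \<circ> r)"
proof
  assume eq: "congruence_of r = congruence_of q"
  then have rq: "r a = r b \<longleftrightarrow> q a = q b" for a b by (auto simp: congruence_of_def set_eq_iff)
  define \<phi> where "\<phi> = q \<circ> inv r"
  have sr: "surj r" and sq: "surj q" using r q by (auto simp: sublocale_map_def)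
  have \<phi>r: "\<phi> (r a) = q a" for a
    by (simp add: \<phi>_def rq[symmetric] surj_f_inv_f[OF sr])
  have "inj \<phi>" by (rule injI) (metis \<phi>r rq sr surj_def)
  moreover have "surj \<phi>" by (metis \<phi>r sq surj_def)
  moreover have "frame_hom \<phi>"
    unfolding frame_hom_def
  proof (intro conjI allI)
    show "\<phi> top = top" using r q \<phi>r[of top] by (simp add: sublocale_map_def frame_hom_def)
    fix x y
    obtain a b where "x = r a" "y = r b" using sr by (metis surj_def)
    then show "\<phi> (inf x y) = inf (\<phi> x) (\<phi> y)"
      using r q \<phi>r[of "inf a b"] by (simp add: sublocale_map_def frame_hom_def \<phi>r)
  next
    fix A
    obtain B where "A = r ` B" using sr by (metis subset_UNIV subset_image_iff)
    then show "\<phi> (Sup A) = Sup (\<phi> ` A)"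
      using r q \<phi>r[of "Sup B"] by (simp add: sublocale_map_def frame_hom_def \<phi>r image_image)
  qed
  ultimately show "\<exists>\<phi>. frame_hom \<phi> \<and> bij \<phi> \<and> q = \<phi> \<circ> r"
    using \<phi>r by (intro exI[of _ \<phi>]) (auto simp: bij_def fun_eq_iff)
next
  assume "\<exists>\<phi>. frame_hom \<phi> \<and> bij \<phi> \<and> q = \<phi> \<circ> r"
  then show "congruence_of r = congruence_of q"
    by (auto simp: congruence_of_def bij_def inj_eq)
qed

text \<open>The frame \<open>{p. u \<le> p}\<close> is the image of \<open>\<lambda>p. sup p u\<close>, so as a sublocale this quotient is given
  by the congruence of that map.\<close>

definition closed_sublocale :: "('a::frame \<Rightarrow> 'r::frame) \<Rightarrow> bool" where
  "closed_sublocale r \<longleftrightarrow> sublocale_map r \<and>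
     (\<exists>u. congruence_of r = congruence_of (\<lambda>p. sup p u))"


section \<open>Localic relations\<close>

definition localic_relation :: "(('a::frame, 'a) coprod \<Rightarrow> 'r::frame) \<Rightarrow> bool" where
  "localic_relation r \<longleftrightarrow> sublocale_map r"

definition rel_source :: "(('a::frame, 'a) coprod \<Rightarrow> 'r::frame) \<Rightarrow> 'a \<Rightarrow> 'r" where
  "rel_source r = r \<circ> pr1"

definition rel_target :: "(('a::frame, 'a) coprod \<Rightarrow> 'r::frame) \<Rightarrow> 'a \<Rightarrow> 'r" where
  "rel_target r = r \<circ> pr2"

definition open_source :: "(('a::frame, 'a) coprod \<Rightarrow> 'r::frame) \<Rightarrow> bool" where
  "open_source r \<longleftrightarrow> open_locale_map (rel_source r)"

definition induced_cone :: "(('a::frame, 'a) coprod \<Rightarrow> 'r::frame) \<Rightarrow> 'a \<Rightarrow> 'a" where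
  "induced_cone r = direct_image (rel_source r) \<circ> rel_target r"

lemma induced_cone_Sup:
  assumes r: "localic_relation r" and o: "open_source r"
  shows "induced_cone r (Sup A) = Sup (induced_cone r ` A)"
proof -
  obtain g where g: "left_adjoint g (rel_source r)"
    using o by (auto simp: open_source_def open_locale_map_def)
  have gV: "g (Sup B) \<le> V \<longleftrightarrow> Sup (g ` B) \<le> V" for B V
    using g by (simp add: left_adjoint_def Sup_le_iff)
  have g_Sup: "g (Sup B) = Sup (g ` B)" for B
    using gV[of B "g (Sup B)"] gV[of B "Sup (g ` B)"] by (intro order.antisym) simp_all
  have t_Sup: "rel_target r (Sup A) = Sup (rel_target r ` A)"
  proof -
    have "r (pr2 (Sup A)) = r (Sup (pr2 ` A))"
      using frame_hom_pr2 unfolding frame_hom_def by metis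
    also have "\<dots> = Sup (r ` pr2 ` A)"
      using r unfolding localic_relation_def sublocale_map_def frame_hom_def by blast
    finally show ?thesis by (simp only: rel_target_def o_apply image_comp)
  qed
  show ?thesis
    unfolding induced_cone_def direct_image_eq[OF g] o_apply t_Sup g_Sup
    by (simp only: image_comp o_def)
qed

text \<open>The relation induced by \<open>v\<close>, as a frame congruence; it is used for join-preserving \<open>v\<close>.\<close>

definition induced_relation :: "('a::frame \<Rightarrow> 'a) \<Rightarrow> (('a, 'a) coprod \<times> ('a, 'a) coprod) set" where
  "induced_relation v =
     \<Inter>{\<theta>. frame_congruence \<theta> \<and> (\<forall>x y. (x \<otimes> y, inf x (v y) \<otimes> y) \<in> \<theta>)}"

lemma frame_congruence_Inter:
  assumes T: "\<And>\<theta>. \<theta> \<in> T \<Longrightarrow> frame_congruence \<theta>"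
  shows "frame_congruence (\<Inter>T)"
  unfolding frame_congruence_def
proof (intro conjI allI impI)
  have eq: "equiv UNIV \<theta>" if "\<theta> \<in> T" for \<theta>
    using T[OF that] by (simp add: frame_congruence_def)
  show "equiv UNIV (\<Inter>T)"
  proof (rule equivI)
    show "refl (\<Inter>T)"
      by (intro refl_onI InterI) (meson eq equivE refl_onD UNIV_I)
    show "sym (\<Inter>T)"
      by (intro symI InterI) (meson eq equivE symD InterD)
    show "trans (\<Inter>T)"
      by (intro transI InterI) (meson eq equivE transD InterD)
  qed simp
next
  fix a a' b b' assume "(a, a') \<in> \<Inter>T" "(b, b') \<in> \<Inter>T"
  then show "(inf a b, inf a' b') \<in> \<Inter>T"
    using T unfolding frame_congruence_def Inter_iff by meson
next
  fix S assume S: "S \<subseteq> \<Inter>T"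
  show "(Sup (fst ` S), Sup (snd ` S)) \<in> \<Inter>T"
  proof (rule InterI)
    fix \<theta> assume "\<theta> \<in> T"
    then have "frame_congruence \<theta>" "S \<subseteq> \<theta>" using T S by auto
    then show "(Sup (fst ` S), Sup (snd ` S)) \<in> \<theta>" by (simp add: frame_congruence_def)
  qed
qed

lemma induced_relation_least:
  shows "frame_congruence (induced_relation v)"
    and "(x \<otimes> y, inf x (v y) \<otimes> y) \<in> induced_relation v"
    and "frame_congruence \<theta> \<Longrightarrow> (\<And>x y. (x \<otimes> y, inf x (v y) \<otimes> y) \<in> \<theta>) \<Longrightarrow> induced_relation v \<subseteq> \<theta>"
  unfolding induced_relation_def by (auto intro!: frame_congruence_Inter)

end

theory Submission
  imports Defs
begin

text \<open>Writing \<open>s\<close>, \<open>t\<close> for source and target, \<open>R\<close> identifies \<open>x \<otimes> y\<close> with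
  \<open>(x \<and> \<Down>y) \<otimes> y\<close> because \<open>t y \<le> s (\<Down>y)\<close> is the unit of the adjunction. Conversely, if \<open>R\<close> is
  the closed sublocale given by \<open>u\<close>, then it is the smallest sublocale congruence collapsing \<open>u\<close>
  to bottom. For a rectangle \<open>x \<otimes> y \<le> u\<close> one has \<open>s x \<and> t y = \<bottom>\<close>, so openness of \<open>s\<close> gives
  \<open>x \<and> \<Down>y = \<bottom>\<close>, and the generating identification already collapses \<open>x \<otimes> y\<close>; as \<open>u\<close> is the join
  of the rectangles below it, the induced congruence collapses \<open>u\<close>.\<close>

lemma frame_hom_bot: "frame_hom f \<Longrightarrow> f bot = bot"
  unfolding frame_hom_def by (metis Sup_empty image_empty)

lemma left_adjoint_bot:
  fixes g :: "'b::complete_lattice \<Rightarrow> 'c::complete_lattice"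
  assumes "left_adjoint g f"
  shows "g bot = bot"
  using assms unfolding left_adjoint_def by (metis bot.extremum bot.extremum_uniqueI)

lemma rect_bot_left: "bot \<otimes> y = bot"
  using rect_Sup_left[of "{}" y] by simp

lemma frame_congruence_refl: "frame_congruence \<theta> \<Longrightarrow> (a, a) \<in> \<theta>"
  unfolding frame_congruence_def equiv_def by (meson UNIV_I refl_onD)

lemma frame_congruence_sym: "frame_congruence \<theta> \<Longrightarrow> (a, b) \<in> \<theta> \<Longrightarrow> (b, a) \<in> \<theta>"
  unfolding frame_congruence_def equiv_def by (meson symD)

lemma frame_congruence_trans:
  "frame_congruence \<theta> \<Longrightarrow> (a, b) \<in> \<theta> \<Longrightarrow> (b, c) \<in> \<theta> \<Longrightarrow> (a, c) \<in> \<theta>"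
  unfolding frame_congruence_def equiv_def by (meson transD)

text \<open>Closure under joins is given for sets of congruent pairs; the set of all
  \<open>(f i, g i)\<close> transfers it to indexed families.\<close>

lemma frame_congruence_SUP:
  assumes "frame_congruence \<theta>" and "\<And>i. i \<in> I \<Longrightarrow> (f i, g i) \<in> \<theta>"
  shows "(SUP i\<in>I. f i, SUP i\<in>I. g i) \<in> \<theta>"
proof -
  have "(\<lambda>i. (f i, g i)) ` I \<subseteq> \<theta>" using assms(2) by auto
  then have "(Sup (fst ` (\<lambda>i. (f i, g i)) ` I), Sup (snd ` (\<lambda>i. (f i, g i)) ` I)) \<in> \<theta>"
    using assms(1) unfolding frame_congruence_def by blast
  then show ?thesis by (simp add: image_image)
qed

lemma frame_congruence_sup:
  assumes "frame_congruence \<theta>" and "(a, a') \<in> \<theta>" and "(b, b') \<in> \<theta>"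
  shows "(sup a b, sup a' b') \<in> \<theta>"
  \<comment> \<open>The two pairs serve as their own index set, with the projections as
    families.\<close>
  using frame_congruence_SUP[of \<theta> "{(a, a'), (b, b')}" fst snd] assms by auto

text \<open>Joining \<open>(p, p)\<close> with \<open>(u, bot)\<close> gives
  \<open>(sup p u, p)\<close>, so \<open>a\<close> and \<open>b\<close> are linked through their
  common join with \<open>u\<close>.\<close>

lemma congruence_of_closed_subset:
  assumes \<theta>: "frame_congruence \<theta>" and u: "(u, bot) \<in> \<theta>"
  shows "congruence_of (\<lambda>p. sup p u) \<subseteq> \<theta>"
proof clarify
  fix a b assume "(a, b) \<in> congruence_of (\<lambda>p. sup p u)"
  then have ab: "sup a u = sup b u" by (simp add: congruence_of_def)
  have *: "(sup p u, p) \<in> \<theta>" for p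
    using frame_congruence_sup[OF \<theta> frame_congruence_refl[OF \<theta>] u, of p] by simp
  show "(a, b) \<in> \<theta>"
    using frame_congruence_trans[OF \<theta> frame_congruence_sym[OF \<theta> *[of a]]] *[of b] ab by simp
qed

lemma rel_rect:
  assumes "localic_relation r"
  shows "r (x \<otimes> y) = inf (rel_source r x) (rel_target r y)"
  using assms
  by (simp add: localic_relation_def sublocale_map_def frame_hom_def rect_eq_inf_pr
      rel_source_def rel_target_def)

lemma induced_relation_subset:
  assumes r: "localic_relation r" and o: "open_source r"
  shows "induced_relation (induced_cone r) \<subseteq> congruence_of r"
proof (rule induced_relation_least(3))
  show "frame_congruence (congruence_of r)"
    using r by (simp add: localic_relation_def sublocale_map_def frame_congruence_of)
  fix x y
  obtain g where g: "left_adjoint g (rel_source r)" and s: "frame_hom (rel_source r)"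
    using o by (auto simp: open_source_def open_locale_map_def)
  have "rel_target r y \<le> rel_source r (induced_cone r y)"
    using g by (simp add: induced_cone_def direct_image_eq[OF g] flip: g[unfolded left_adjoint_def, rule_format])
  \<comment> \<open>As \<open>rel_source r\<close> preserves meets, the extra factor is absorbed by
    \<open>rel_target r y\<close>.\<close>
  then have "inf (rel_source r (inf x (induced_cone r y))) (rel_target r y)
      = inf (rel_source r x) (rel_target r y)"
    using s by (simp add: frame_hom_def inf_assoc inf_absorb2)
  then show "(x \<otimes> y, inf x (induced_cone r y) \<otimes> y) \<in> congruence_of r"
    by (simp add: congruence_of_def rel_rect[OF r])
qed

text \<open>By the Frobenius law \<open>frob\<close> the meet equals
  \<open>g (r (x \<otimes> y))\<close>, and a left adjoint preserves bottom.\<close>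

lemma inf_induced_cone_eq_bot:
  assumes r: "localic_relation r" and o: "open_source r" and bot: "r (x \<otimes> y) = bot"
  shows "inf x (induced_cone r y) = bot"
proof -
  obtain g where g: "left_adjoint g (rel_source r)"
    and frob: "\<And>U V. g (inf U (rel_source r V)) = inf (g U) V"
    using o by (auto simp: open_source_def open_locale_map_def)
  have "inf x (induced_cone r y) = g (inf (rel_target r y) (rel_source r x))"
    by (simp add: frob induced_cone_def direct_image_eq[OF g] inf_commute[of x])
  also have "\<dots> = g (r (x \<otimes> y))" unfolding rel_rect[OF r] by (subst inf_commute) (rule refl)
  also have "\<dots> = bot" using bot left_adjoint_bot[OF g] by simp
  finally show ?thesis .
qed

theorem proposition4p27:
  fixes r :: "('a::frame, 'a) coprod \<Rightarrow> 'r::frame"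
  assumes "localic_relation r"
    and "closed_sublocale r"
    and "open_source r"
  shows "congruence_of r = induced_relation (induced_cone r)"
proof
  let ?\<theta> = "induced_relation (induced_cone r)"
  note cong = induced_relation_least(1)[of "induced_cone r"]
  have hom: "frame_hom r" using assms(1) by (simp add: localic_relation_def sublocale_map_def)
  obtain u where u: "congruence_of r = congruence_of (\<lambda>p. sup p u)"
    using assms(2) by (auto simp: closed_sublocale_def)
  \<comment> \<open>Both \<open>u\<close> and \<open>bot\<close> have join \<open>u\<close> with
    \<open>u\<close>.\<close>
  have "(u, bot) \<in> congruence_of r" by (simp add: u) (simp add: congruence_of_def)
  then have ru: "r u = bot" by (simp add: congruence_of_def frame_hom_bot[OF hom])
  have collapse: "(x \<otimes> y, bot) \<in> ?\<theta>" if "(x, y) \<in> opens_below u" for x y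
  proof -
    have "r (x \<otimes> y) \<le> r u" using that by (intro frame_hom_mono[OF hom]) (simp add: rect_le_iff)
    then have "inf x (induced_cone r y) = bot"
      by (intro inf_induced_cone_eq_bot assms) (simp add: ru bot_unique)
    \<comment> \<open>The generating pair now reads
      \<open>(x \<otimes> y, bot \<otimes> y)\<close>.\<close>
    then show ?thesis
      using induced_relation_least(2)[of x y "induced_cone r"] by (simp add: rect_bot_left)
  qed
  \<comment> \<open>All rectangles below \<open>u\<close> collapse at once: the left join is
    \<open>u\<close>, the right one is \<open>bot\<close>.\<close>
  have "(SUP (x, y)\<in>opens_below u. x \<otimes> y, SUP p\<in>opens_below u. bot) \<in> ?\<theta>"
    by (rule frame_congruence_SUP[OF cong]) (auto intro: collapse)
  moreover have "(SUP p\<in>opens_below u. bot :: ('a, 'a) coprod) = bot"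
    by (auto intro: bot.extremum_uniqueI SUP_least)
  ultimately have "(u, bot) \<in> ?\<theta>"
    using coprod_eq_Sup_rect[of u] by metis
  then show "congruence_of r \<subseteq> ?\<theta>"
    unfolding u by (rule congruence_of_closed_subset[OF cong])
  show "?\<theta> \<subseteq> congruence_of r"
    by (rule induced_relation_subset[OF assms(1,3)])
qed

end
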